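(* Let $G=(V,E)$ be a simple graph and $X\subseteq E$ a non-empty set of edges such that $G[X]$ is not a star graph. Let $M$ be any maximal matching of $G[X]$ and let $C$ be the set of all endpoints of edges of $M$. Then $\mathrm{TSP}^*(C,d_G) \le 3\,\mathrm{OPT}$, where $\mathrm{OPT}$ is the minimum length of a cycle (not necessarily simple) of $G$ covering $X$.
   Context: A cycle (not necessarily simple) of $G$ is a closed walk, possibly a single vertex (length $0$); its length is the number of edges counting repetitions. A cycle covers $X$ if every edge of $X$ has an endpoint among its vertices. $G[X]$ is the subgraph induced by the edge set $X$. A star graph is $K_{1,n}$ for some $n\ge1$. $d_G$ is the shortest-path distance of $G$. $\mathrm{TSP}^*(C,d_G)$ is the minimum, over all Hamiltonian cycles $\langle t_1,\dots,t_k,t_1\rangle$ of the complete graph on $C$, of $\sum_i d_G(t_i,t_{i+1})$. *)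

theory Defs
  imports Main "HOL-Library.Extended_Nat"
begin

type_synonym 'a ugraph = "'a set \<times> 'a set set"

abbreviation verts :: "'a ugraph \<Rightarrow> 'a set" where "verts G \<equiv> fst G"
abbreviation edges :: "'a ugraph \<Rightarrow> 'a set set" where "edges G \<equiv> snd G"

definition simple_graph :: "'a ugraph \<Rightarrow> bool" where
  "simple_graph G \<longleftrightarrow> finite (verts G) \<and> (\<forall>e\<in>edges G. e \<subseteq> verts G \<and> card e = 2)"

definition edge_induced :: "'a set set \<Rightarrow> 'a ugraph" where
  "edge_induced X = (\<Union>X, X)"

text \<open>A graph that is a copy of \<open>K\<^sub>1\<^sub>,\<^sub>n\<close> with centre \<open>c\<close> and leaf set \<open>L\<close>, for some \<open>n \<ge> 1\<close>.\<close>

definition star_graph :: "'a ugraph \<Rightarrow> bool" where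
  "star_graph G \<longleftrightarrow> (\<exists>n::nat. n \<ge> 1 \<and> (\<exists>c L. finite L \<and> card L = n \<and> c \<notin> L \<and>
     verts G = insert c L \<and> edges G = {{c, v} | v. v \<in> L}))"

definition matching :: "'a ugraph \<Rightarrow> 'a set set \<Rightarrow> bool" where
  "matching G M \<longleftrightarrow> M \<subseteq> edges G \<and> pairwise disjnt M"

definition maximal_matching :: "'a ugraph \<Rightarrow> 'a set set \<Rightarrow> bool" where
  "maximal_matching G M \<longleftrightarrow> matching G M \<and> (\<forall>M'. matching G M' \<and> M \<subseteq> M' \<longrightarrow> M' = M)"

text \<open>Walks are non-empty vertex lists. A closed walk lists its base vertex both first and
  last, so \<open>[v]\<close> is the closed walk of length 0 at \<open>v\<close>.\<close>

definition walk :: "'a ugraph \<Rightarrow> 'a list \<Rightarrow> bool" where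
  "walk G p \<longleftrightarrow> p \<noteq> [] \<and> set p \<subseteq> verts G \<and> successively (\<lambda>u v. {u, v} \<in> edges G) p"

definition walk_length :: "'a list \<Rightarrow> nat" where
  "walk_length p = length p - 1"

definition closed_walk :: "'a ugraph \<Rightarrow> 'a list \<Rightarrow> bool" where
  "closed_walk G p \<longleftrightarrow> walk G p \<and> hd p = last p"

definition path_between :: "'a ugraph \<Rightarrow> 'a \<Rightarrow> 'a \<Rightarrow> 'a list \<Rightarrow> bool" where
  "path_between G u v p \<longleftrightarrow> walk G p \<and> distinct p \<and> hd p = u \<and> last p = v"

text \<open>Minima are infima in \<^typ>\<open>enat\<close>: a non-empty set of values attains its infimum,
  and the infimum of the empty set is \<open>\<infinity>\<close> (no path, or no covering cycle).\<close>

definition graph_dist :: "'a ugraph \<Rightarrow> 'a \<Rightarrow> 'a \<Rightarrow> enat" where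
  "graph_dist G u v = (INF p\<in>{p. path_between G u v p}. enat (walk_length p))"

definition covers :: "'a list \<Rightarrow> 'a set set \<Rightarrow> bool" where
  "covers p X \<longleftrightarrow> (\<forall>e\<in>X. \<exists>v\<in>e. v \<in> set p)"

definition opt_cover :: "'a ugraph \<Rightarrow> 'a set set \<Rightarrow> enat" where
  "opt_cover G X = (INF p\<in>{p. closed_walk G p \<and> covers p X}. enat (walk_length p))"

text \<open>The list \<open>[t\<^sub>1, \<dots>, t\<^sub>k]\<close> stands for the cycle \<open>\<langle>t\<^sub>1, \<dots>, t\<^sub>k, t\<^sub>1\<rangle>\<close>. For \<open>k = 2\<close> this is the
  round trip \<open>\<langle>t\<^sub>1, t\<^sub>2, t\<^sub>1\<rangle>\<close>, which is admitted as a Hamiltonian cycle.\<close>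

definition hamiltonian_cycle_on :: "'a set \<Rightarrow> 'a list \<Rightarrow> bool" where
  "hamiltonian_cycle_on C t \<longleftrightarrow> distinct t \<and> set t = C"

definition tour_cost :: "('a \<Rightarrow> 'a \<Rightarrow> enat) \<Rightarrow> 'a list \<Rightarrow> enat" where
  "tour_cost d t = (\<Sum>i<length t. d (t ! i) (t ! (Suc i mod length t)))"

definition tsp :: "'a set \<Rightarrow> ('a \<Rightarrow> 'a \<Rightarrow> enat) \<Rightarrow> enat" where
  "tsp C d = (INF t\<in>{t. hamiltonian_cycle_on C t}. tour_cost d t)"

end

theory Submission
  imports Defs "HOL-Library.Sublist"
begin

text \<open>Given a covering closed walk, replace each step's starting vertex \<open>u\<close> by the detour
  \<open>u, m u, u\<close>, where \<open>m u\<close> is the partner of \<open>u\<close> in \<open>M\<close> (and \<open>m u = u\<close> for unmatched \<open>u\<close>). This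
  at most triples the length. Every edge of \<open>M\<close> has an endpoint on the walk, so the new walk meets
  all of \<open>C\<close>, and shortcutting it yields the tour. The star case is excluded because a walk of
  length \<open>0\<close> has no steps to charge the detours to.\<close>

section \<open>Costs of open routes and closed tours, and shortcutting\<close>

fun route_cost :: "('a \<Rightarrow> 'a \<Rightarrow> enat) \<Rightarrow> 'a list \<Rightarrow> enat" where
  "route_cost d (x # y # zs) = d x y + route_cost d (y # zs)"
| "route_cost d _ = 0"

lemma route_cost_append:
  "route_cost d (xs @ y # ys) = route_cost d (xs @ [y]) + route_cost d (y # ys)"
  by (induction d xs rule: route_cost.induct) (auto simp: add.assoc neq_Nil_conv)

lemma route_cost_conv_sum:
  "route_cost d xs = (\<Sum>i<length xs - 1. d (xs ! i) (xs ! Suc i))"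
proof (induction d xs rule: route_cost.induct)
  case (1 d x y zs)
  then show ?case
    by (simp add: sum.lessThan_Suc_shift del: sum.lessThan_Suc)
qed auto

text \<open>Repeating the head at the end turns the modular index into an ordinary successor, which
  makes tours accessible to list induction.\<close>

lemma tour_cost_conv_route_cost:
  assumes "t \<noteq> []"
  shows "tour_cost d t = route_cost d (t @ [hd t])"
proof -
  have "d (t ! i) (t ! (Suc i mod length t)) = d ((t @ [hd t]) ! i) ((t @ [hd t]) ! Suc i)"
    if "i < length t" for i
    using that assms by (cases "Suc i = length t") (auto simp: nth_append hd_conv_nth)
  then show ?thesis
    by (simp add: tour_cost_def route_cost_conv_sum)
qed

text \<open>Each dropped vertex is bypassed by one use of the triangle inequality. The start
  \<open>a\<close> varies in the induction because a kept vertex becomes the start of the remaining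
  route.\<close>

lemma route_cost_shortcut:
  fixes d :: "'a \<Rightarrow> 'a \<Rightarrow> enat"
  assumes "\<And>u v w. d u w \<le> d u v + d v w" and "subseq ys xs"
  shows "route_cost d (a # ys @ [b]) \<le> route_cost d (a # xs @ [b])"
  using assms(2)
proof (induction xs arbitrary: a ys rule: list.induct)
  case Nil
  then show ?case by (auto dest: list_emb_Nil2)
next
  case (Cons x xs)
  show ?case
  proof (cases "\<exists>ys'. ys = x # ys' \<and> subseq ys' xs")
    case True
    then show ?thesis using Cons.IH by (auto intro: add_left_mono)
  next
    case False
    with Cons.prems have "subseq ys xs" by (auto elim: list_emb.cases)
    then have "route_cost d (a # ys @ [b]) \<le> route_cost d (a # xs @ [b])" by (rule Cons.IH)
    \<comment> \<open>\<open>z\<close> is the vertex that follows \<open>x\<close>; the fixed end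
      \<open>b\<close> provides one even when \<open>xs\<close> is empty.\<close>
    also obtain z zs where z: "xs @ [b] = z # zs" by (cases "xs @ [b]") auto
    have "route_cost d (a # xs @ [b]) \<le> d a x + route_cost d (x # xs @ [b])"
      using add_right_mono[OF assms(1)] by (simp add: z add.assoc[symmetric])
    finally show ?thesis by simp
  qed
qed

text \<open>If the head is kept, both tours open and close at it, so the bound for routes applies.
  Otherwise the head is bypassed and the tour restarts at its successor.\<close>

lemma tour_cost_shortcut:
  fixes d :: "'a \<Rightarrow> 'a \<Rightarrow> enat"
  assumes triangle: "\<And>u v w. d u w \<le> d u v + d v w" and "subseq ys xs"
  shows "tour_cost d ys \<le> tour_cost d xs"
  using assms(2)
proof (induction xs arbitrary: ys rule: list.induct)
  case Nil
  then show ?case by (auto dest: list_emb_Nil2)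
next
  case (Cons x xs)
  show ?case
  proof (cases "\<exists>ys'. ys = x # ys' \<and> subseq ys' xs")
    case True
    then show ?thesis
      using route_cost_shortcut[of d, OF triangle] by (auto simp: tour_cost_conv_route_cost)
  next
    case False
    with Cons.prems have "subseq ys xs" by (auto elim: list_emb.cases)
    then have "tour_cost d ys \<le> tour_cost d xs" by (rule Cons.IH)
    also have "\<dots> \<le> tour_cost d (x # xs)"
    proof (cases xs)
      case Nil
      then show ?thesis by (simp add: tour_cost_def)
    next
      case (Cons y zs)
      \<comment> \<open>The tour is rotated to start at \<open>y\<close>, so that \<open>x\<close>
        becomes an interior vertex, just before the return to \<open>y\<close>.\<close>
      have "route_cost d (y # zs @ [y]) \<le> route_cost d (y # zs @ [x, y])"
        using route_cost_shortcut[of d zs "zs @ [x]" y y, OF triangle] by (simp add: list_emb_prefix)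
      also have "\<dots> = route_cost d (y # zs @ [x]) + d x y"
        using route_cost_append[of d "y # zs" x "[y]"] by simp
      finally show ?thesis by (simp add: Cons tour_cost_conv_route_cost add.commute)
    qed
    finally show ?thesis .
  qed
qed

lemma subseq_remdups: "subseq (remdups xs) xs"
  by (induction xs) auto

text \<open>Deleting the entries outside \<open>C\<close> and all but one occurrence of each
  remaining vertex leaves a Hamiltonian cycle on \<open>C\<close> that is a subsequence of
  \<open>xs\<close>.\<close>

lemma tsp_le_tour_cost:
  assumes "\<And>u v w. d u w \<le> d u v + d v w" and "C \<subseteq> set xs"
  shows "tsp C d \<le> tour_cost d xs"
proof -
  let ?t = "remdups (filter (\<lambda>x. x \<in> C) xs)"
  have "hamiltonian_cycle_on C ?t"
    using assms(2) by (auto simp: hamiltonian_cycle_on_def)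
  then have "tsp C d \<le> tour_cost d ?t"
    unfolding tsp_def by (intro INF_lower) simp
  also have "\<dots> \<le> tour_cost d xs"
    using assms(1) subseq_order.trans[OF subseq_remdups subseq_filter_left]
    by (rule tour_cost_shortcut)
  finally show ?thesis .
qed

text \<open>Each vertex of \<open>us\<close> pays for three steps of cost at most 1: to its partner,
  back, and on to the next vertex of the walk.\<close>

lemma route_cost_detours:
  fixes d :: "'a \<Rightarrow> 'a \<Rightarrow> enat"
  assumes "\<And>u. u \<in> set us \<Longrightarrow> d u (m u) \<le> 1" and "\<And>u. u \<in> set us \<Longrightarrow> d (m u) u \<le> 1"
    and "successively (\<lambda>u v. d u v \<le> 1) (us @ [z])"
  shows "route_cost d (concat (map (\<lambda>u. [u, m u, u]) us) @ [z]) \<le> 3 * enat (length us)"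
  using assms
proof (induction us)
  case Nil
  then show ?case by simp
next
  case (Cons u us)
  let ?r = "concat (map (\<lambda>u. [u, m u, u]) us) @ [z]"
  obtain v zs where v: "?r = v # zs" by (cases ?r) auto
  \<comment> \<open>Every block begins with its own walk vertex, so the step leaving the block of
    \<open>u\<close> is a step of the original walk.\<close>
  have "v = hd (us @ [z])" using arg_cong[OF v, of hd] by (cases us) auto
  then have step: "d u v \<le> 1" using Cons.prems(3) by (cases us) auto
  have "successively (\<lambda>u v. d u v \<le> 1) (us @ [z])" using Cons.prems(3) by (cases us) auto
  then have IH: "route_cost d ?r \<le> 3 * enat (length us)" using Cons by simp
  have "route_cost d (concat (map (\<lambda>u. [u, m u, u]) (u # us)) @ [z])
      = d u (m u) + (d (m u) u + (d u v + route_cost d ?r))"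
    using v by simp
  also have "\<dots> \<le> 1 + (1 + (1 + 3 * enat (length us)))"
    using Cons.prems(1,2)[of u] step IH by (intro add_mono) auto
  also have "\<dots> = 3 * enat (length (u # us))"
    by (simp add: one_enat_def numeral_eq_enat)
  finally show ?case .
qed

section \<open>Walks and the shortest-path distance\<close>

lemma path_between_of_walk:
  assumes "walk G p"
  shows "\<exists>q. path_between G (hd p) (last p) q \<and> length q \<le> length p"
  using assms
proof (induction p rule: length_induct)
  case (1 p)
  show ?case
  proof (cases "distinct p")
    case True
    then show ?thesis using 1 by (auto simp: path_between_def)
  next
    case False
    then obtain xs ys zs y where p: "p = xs @ [y] @ ys @ [y] @ zs"
      using not_distinct_decomp by blast
    \<comment> \<open>Cutting out the closed piece between two occurrences of \<open>y\<close> keeps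
      both ends and strictly shortens the walk.\<close>
    let ?q = "xs @ [y] @ zs"
    have "walk G ?q" using 1 unfolding p walk_def
      by (auto simp: successively_append_iff successively_Cons)
    moreover have "hd ?q = hd p" "last ?q = last p" "length ?q < length p"
      unfolding p by (cases xs; simp)+
    ultimately show ?thesis using "1.IH" by (metis less_imp_le order.trans)
  qed
qed

text \<open>\<open>graph_dist\<close> ranges over paths without repetition; this admits arbitrary
  walks as upper bounds.\<close>

lemma graph_dist_le_walk_length:
  assumes "walk G p" and "hd p = u" and "last p = v"
  shows "graph_dist G u v \<le> enat (walk_length p)"
proof -
  obtain q where q: "path_between G u v q" "length q \<le> length p"
    using path_between_of_walk assms by blast
  then have "graph_dist G u v \<le> enat (walk_length q)"
    unfolding graph_dist_def by (intro INF_lower) simp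
  also have "\<dots> \<le> enat (walk_length p)" using q(2) by (simp add: walk_length_def)
  finally show ?thesis .
qed

text \<open>A finite infimum rules out the empty family, whose infimum is the top element
  \<open>\<infinity>\<close>; well-ordering then yields a minimiser.\<close>

lemma INF_enat_attained:
  fixes f :: "'a \<Rightarrow> enat"
  assumes "(INF x\<in>A. f x) \<noteq> \<infinity>"
  obtains x where "x \<in> A" "(INF x\<in>A. f x) = f x"
proof -
  from assms obtain x where "x \<in> A" by (cases "A = {}") (auto simp: top_enat_def)
  then have "(INF x\<in>A. f x) \<in> f ` A" by (intro wellorder_InfI) auto
  then show thesis using that by blast
qed

text \<open>Two shortest paths are joined at \<open>v\<close>. The result may repeat vertices, but
  it is a walk and so bounds the distance.\<close>

lemma graph_dist_triangle: "graph_dist G u w \<le> graph_dist G u v + graph_dist G v w"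
proof (cases "graph_dist G u v = \<infinity> \<or> graph_dist G v w = \<infinity>")
  case True
  then show ?thesis by auto
next
  case False
  obtain p where p: "path_between G u v p" "graph_dist G u v = enat (walk_length p)"
    using INF_enat_attained False unfolding graph_dist_def by (metis mem_Collect_eq)
  obtain q where q: "path_between G v w q" "graph_dist G v w = enat (walk_length q)"
    using INF_enat_attained False unfolding graph_dist_def by (metis mem_Collect_eq)
  \<comment> \<open>Both paths contain \<open>v\<close>; splitting it off lets the joined list
    contain it once, so the lengths add exactly.\<close>
  from p(1) obtain p' where p': "p = p' @ [v]"
    by (metis append_butlast_last_id path_between_def walk_def)
  from q(1) obtain q' where q': "q = v # q'"
    by (metis list.collapse path_between_def walk_def)
  have "walk G (p' @ v # q')" "hd (p' @ v # q') = u" "last (p' @ v # q') = w"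
    using p(1) q(1) unfolding p' q'
    by (auto simp: path_between_def walk_def successively_append_iff successively_Cons hd_append
        split: if_splits)
  from graph_dist_le_walk_length[OF this]
  show ?thesis unfolding p(2) q(2) by (simp add: walk_length_def p' q')
qed

lemma graph_dist_self:
  assumes "u \<in> verts G"
  shows "graph_dist G u u = 0"
  using graph_dist_le_walk_length[of G "[u]" u u] assms
  by (simp add: walk_def walk_length_def zero_enat_def[symmetric])

lemma graph_dist_edge:
  assumes "{u, v} \<in> edges G" and "{u, v} \<subseteq> verts G"
  shows "graph_dist G u v \<le> 1"
  using graph_dist_le_walk_length[of G "[u, v]" u v] assms
  by (simp add: walk_def walk_length_def one_enat_def)

section \<open>Edge sets with a common vertex, and partners in a matching\<close>

lemma star_graph_edge_inducedI:
  assumes "finite X" and "X \<noteq> {}" and "\<And>e. e \<in> X \<Longrightarrow> card e = 2 \<and> c \<in> e"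
  shows "star_graph (edge_induced X)"
proof -
  define L where "L = \<Union>X - {c}"
  have edge: "\<exists>w. w \<noteq> c \<and> e = {c, w}" if "e \<in> X" for e
    using assms(3)[OF that] by (auto simp: card_2_iff)
  have X: "X = {{c, v} | v. v \<in> L}"
  proof (intro equalityI subsetI)
    fix e assume e: "e \<in> X"
    then obtain w where w: "w \<noteq> c" "e = {c, w}" using edge by blast
    then have "w \<in> L" using e by (auto simp: L_def)
    then show "e \<in> {{c, v} | v. v \<in> L}" using w(2) by blast
  next
    fix e assume "e \<in> {{c, v} | v. v \<in> L}"
    then obtain v e' where "e = {c, v}" "v \<noteq> c" "v \<in> e'" "e' \<in> X" by (auto simp: L_def)
    with edge[of e'] show "e \<in> X" by auto
  qed
  \<comment> \<open>Infinite sets have \<open>card\<close> 0, so \<open>card e = 2\<close> makes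
    every edge finite.\<close>
  have "finite (\<Union>X)"
    using assms(1,3) by (metis card.infinite finite_Union zero_neq_numeral)
  then have "finite L" by (simp add: L_def)
  moreover have "L \<noteq> {}" using X assms(2) by auto
  ultimately have "card L \<ge> 1" by (simp add: Suc_le_eq card_gt_0_iff)
  moreover have "\<Union>X = insert c L" using assms(2,3) by (auto simp: L_def)
  moreover have "card L = card L" ..
  moreover have "c \<notin> L" by (simp add: L_def)
  ultimately show ?thesis
    using X \<open>finite L\<close> unfolding star_graph_def edge_induced_def fst_conv snd_conv
    by (intro exI[of _ "card L"] exI[of _ c] exI[of _ L] conjI) assumption+
qed

text \<open>Disjointness leaves at most one edge of \<open>M\<close> at each vertex, so the chosen
  partner is the only one. Fixing the unmatched vertices makes \<open>m\<close> total, and their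
  detours stay in place.\<close>

lemma matching_partner:
  assumes "pairwise disjnt M" and "\<And>e. e \<in> M \<Longrightarrow> card e = 2"
  obtains m where "\<And>u. u \<in> \<Union>M \<Longrightarrow> {u, m u} \<in> M" and "\<And>u. u \<notin> \<Union>M \<Longrightarrow> m u = u"
    and "\<And>u e. e \<in> M \<Longrightarrow> u \<in> e \<Longrightarrow> e = {u, m u}"
proof -
  define m where "m u = (if u \<in> \<Union>M then SOME w. {u, w} \<in> M else u)" for u
  have "\<exists>w. {u, w} \<in> M" if "e \<in> M" "u \<in> e" for u e
    using assms(2)[OF that(1)] that by (auto simp: card_2_iff insert_commute)
  then have m: "{u, m u} \<in> M" if "u \<in> \<Union>M" for u
    using that unfolding m_def by (auto intro: someI_ex)
  moreover have "e = {u, m u}" if "e \<in> M" "u \<in> e" for u e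
  proof (rule ccontr)
    assume "e \<noteq> {u, m u}"
    then have "disjnt e {u, m u}"
      using assms(1) that m[of u] by (intro pairwiseD[of disjnt M]) auto
    then show False using that(2) by (simp add: disjnt_def)
  qed
  moreover have "m u = u" if "u \<notin> \<Union>M" for u
    unfolding m_def using that by (rule if_not_P)
  ultimately show thesis by (intro that[of m])
qed

section \<open>The tour obtained from an optimal covering walk\<close>

theorem theorem3:
  fixes V :: "'a set" and E X M :: "'a set set" and C :: "'a set"
  assumes "simple_graph (V, E)"
    and "X \<subseteq> E" and "X \<noteq> {}"
    and "\<not> star_graph (edge_induced X)"
    and "maximal_matching (edge_induced X) M"
    and "C = \<Union>M"
  shows "tsp C (graph_dist (V, E)) \<le> 3 * opt_cover (V, E) X"
proof (cases "opt_cover (V, E) X = \<infinity>")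
  case True
  then show ?thesis by (simp add: numeral_eq_enat)
next
  case False
  let ?d = "graph_dist (V, E)"
  obtain p where p: "closed_walk (V, E) p" "covers p X"
    and opt: "opt_cover (V, E) X = enat (walk_length p)"
    using INF_enat_attained False unfolding opt_cover_def by (metis (no_types, lifting) mem_Collect_eq)
  have V: "finite V" and E: "\<And>e. e \<in> E \<Longrightarrow> e \<subseteq> V \<and> card e = 2"
    using assms(1) by (auto simp: simple_graph_def)
  have M: "M \<subseteq> X" "pairwise disjnt M"
    using assms(5) by (auto simp: maximal_matching_def matching_def edge_induced_def)
  \<comment> \<open>\<open>us\<close> lists the starting vertices of the steps, so
    \<open>length us\<close> is exactly the length of the closed walk.\<close>
  obtain us z where us: "p = us @ [z]"
    using p(1) by (metis append_butlast_last_id closed_walk_def walk_def)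
  \<comment> \<open>A walk of length 0 would cover \<open>X\<close> by the single vertex
    \<open>z\<close>, making \<open>z\<close> the centre of a star.\<close>
  have "us \<noteq> []"
  proof
    assume "us = []"
    then have z: "card e = 2 \<and> z \<in> e" if "e \<in> X" for e
      using that p(2) E assms(2) by (auto simp: us covers_def)
    have "finite X"
      using V E assms(2) by (auto intro: finite_subset[of X "Pow V"])
    from star_graph_edge_inducedI[OF this assms(3) z] assms(4) show False by simp
  qed
  then have z: "z = hd us" using p(1) by (simp add: us closed_walk_def)
  have M2: "card e = 2" if "e \<in> M" for e
    using that M(1) E assms(2) by blast
  obtain m where m: "\<And>u. u \<in> \<Union>M \<Longrightarrow> {u, m u} \<in> M" "\<And>u. u \<notin> \<Union>M \<Longrightarrow> m u = u"
    "\<And>u e. e \<in> M \<Longrightarrow> u \<in> e \<Longrightarrow> e = {u, m u}"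
    by (rule matching_partner[OF M(2) M2]) (assumption, rule that)
  have edge: "?d u v \<le> 1" if "{u, v} \<in> E" for u v
    using graph_dist_edge[of u v "(V, E)"] E[OF that] that by simp
  have partner: "?d u (m u) \<le> 1" "?d (m u) u \<le> 1" if "u \<in> set us" for u
  proof -
    have "u \<in> V" using that p(1) by (auto simp: us closed_walk_def walk_def)
    moreover have "{u, m u} \<in> E \<and> {m u, u} \<in> E" if "u \<in> \<Union>M"
      using m(1)[OF that] M(1) assms(2) by (auto simp: insert_commute)
    ultimately show "?d u (m u) \<le> 1" "?d (m u) u \<le> 1"
      using edge graph_dist_self[of u "(V, E)"] m(2)[of u] by (cases "u \<in> \<Union>M"; auto)+
  qed
  define xs where "xs = concat (map (\<lambda>u. [u, m u, u]) us)"
  have "C \<subseteq> set xs"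
  proof
    fix c assume "c \<in> C"
    then obtain e where e: "e \<in> M" "c \<in> e" using assms(6) by auto
    then obtain v where v: "v \<in> e" "v \<in> set p" using p(2) M(1) by (auto simp: covers_def)
    \<comment> \<open>Removing the final \<open>z\<close> loses no vertex, since it is also the
      first one.\<close>
    then have "v \<in> set us" using z \<open>us \<noteq> []\<close> by (auto simp: us)
    moreover have "c = v \<or> c = m v" using m(3)[OF e(1) v(1)] e(2) by auto
    ultimately show "c \<in> set xs" by (auto simp: xs_def)
  qed
  then have "tsp C ?d \<le> tour_cost ?d xs"
    by (intro tsp_le_tour_cost graph_dist_triangle)
  \<comment> \<open>The first block starts at \<open>z\<close>, so closing the tour
    \<open>xs\<close> is the same as ending the route at \<open>z\<close>.\<close>
  also have "xs \<noteq> [] \<and> hd xs = z" using \<open>us \<noteq> []\<close> z by (cases us) (auto simp: xs_def)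
  then have "tour_cost ?d xs = route_cost ?d (xs @ [z])"
    by (simp add: tour_cost_conv_route_cost)
  also have "\<dots> \<le> 3 * enat (length us)"
    unfolding xs_def
  proof (intro route_cost_detours partner)
    have "successively (\<lambda>u v. {u, v} \<in> E) (us @ [z])"
      using p(1) by (simp add: us closed_walk_def walk_def)
    then show "successively (\<lambda>u v. ?d u v \<le> 1) (us @ [z])"
      using edge by (auto elim: successively_mono)
  qed
  also have "\<dots> = 3 * opt_cover (V, E) X"
    by (simp add: opt us walk_length_def)
  finally show ?thesis .
qed

end
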